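(* For every finitary coarse space $(X,\mathcal{E})$ there exists a group $G$ such that $(X,\mathcal{E})$ admits an asymorphic embedding into the coarse space $\stackrel{\leftrightarrow}{G}$.
   Context: A coarse structure on a set $X$ is a family $\mathcal{E}$ of subsets of $X\times X$ such that: each $E\in\mathcal{E}$ contains the diagonal $\Delta_X=\{(x,x):x\in X\}$; if $E,E'\in\mathcal{E}$ then $E\circ E'=\{(x,y):\exists z\,((x,z)\in E,\ (z,y)\in E')\}\in\mathcal{E}$ and $E^{-1}=\{(y,x):(x,y)\in E\}\in\mathcal{E}$; if $E\in\mathcal{E}$ and $\Delta_X\subseteq E'\subseteq E$ then $E'\in\mathcal{E}$. The pair $(X,\mathcal{E})$ is a coarse space. A subfamily $\mathcal{E}'\subseteq\mathcal{E}$ is a base for $\mathcal{E}$ if every $E\in\mathcal{E}$ is contained in some $E'\in\mathcal{E}'$. For $x\in X$ put $E[x]=\{y\in X:(x,y)\in E\}$. A coarse space $(X,\mathcal{E})$ is finitary if for each $E\in\mathcal{E}$ there is a natural number $n$ such that $|E[x]|<n$ for each $x\in X$. A mapping $f:X\to X'$ between coarse spaces $(X,\mathcal{E})$ and $(X',\mathcal{E}')$ is macro-uniform if for every $E\in\mathcal{E}$ there is $E'\in\mathcal{E}'$ such that $f(E[x])\subseteq E'[f(x)]$ for each $x\in X$. An injective mapping $f:X\to X'$ is an asymorphic embedding if $f:X\to X'$ and $f^{-1}:f(X)\to X$ are macro-uniform, where $f(X)$ carries the induced coarse structure $\{E'\cap (f(X)\times f(X)):E'\in\mathcal{E}'\}$.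 For a group $G$ with identity $e$, $x,g\in G$ and $F\subseteq G$, write $x^g=g^{-1}xg$ and $x^F=\{x^y:y\in F\}$. $\stackrel{\leftrightarrow}{G}$ denotes the set $G$ endowed with the coarse structure having base $\{\{(x,y)\in G\times G: y\in x^F\}: F\subseteq G \text{ finite},\ e\in F\}$. *)

theory Defs
  imports "HOL-Algebra.Group"
begin

text \<open>
  Entourages of a coarse space on the carrier set \<open>X\<close> are subsets of \<open>X \<times> X\<close>. The family of
  entourages is required to be nonempty, so that it contains the diagonal.
  The ball \<open>E[x]\<close> is \<open>E `` {x}\<close> and composition of entourages is \<open>O\<close>.
\<close>

definition coarse_space :: "'a set \<Rightarrow> ('a \<times> 'a) set set \<Rightarrow> bool" where
  "coarse_space X \<E> \<longleftrightarrow>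
     \<E> \<noteq> {} \<and>
     (\<forall>E\<in>\<E>. E \<subseteq> X \<times> X \<and> Id_on X \<subseteq> E) \<and>
     (\<forall>E\<in>\<E>. \<forall>E'\<in>\<E>. E O E' \<in> \<E>) \<and>
     (\<forall>E\<in>\<E>. converse E \<in> \<E>) \<and>
     (\<forall>E\<in>\<E>. \<forall>E'. Id_on X \<subseteq> E' \<and> E' \<subseteq> E \<longrightarrow> E' \<in> \<E>)"

definition coarse_base :: "('a \<times> 'a) set set \<Rightarrow> ('a \<times> 'a) set set \<Rightarrow> bool" where
  "coarse_base \<B> \<E> \<longleftrightarrow> \<B> \<subseteq> \<E> \<and> (\<forall>E\<in>\<E>. \<exists>B\<in>\<B>. E \<subseteq> B)"

text \<open>The only possible coarse structure on \<open>X\<close> with a given base:\<close>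

definition coarse_of_base :: "'a set \<Rightarrow> ('a \<times> 'a) set set \<Rightarrow> ('a \<times> 'a) set set" where
  "coarse_of_base X \<B> = {E. Id_on X \<subseteq> E \<and> (\<exists>B\<in>\<B>. E \<subseteq> B)}"

lemma coarse_of_base_unique:
  assumes "coarse_space X \<E>" and "coarse_base \<B> \<E>"
  shows "\<E> = coarse_of_base X \<B>"
proof (intro equalityI subsetI)
  fix E assume "E \<in> \<E>"
  moreover have "\<forall>E\<in>\<E>. E \<subseteq> X \<times> X \<and> Id_on X \<subseteq> E"
    using assms(1) unfolding coarse_space_def by (elim conjE)
  ultimately have "Id_on X \<subseteq> E" "\<exists>B\<in>\<B>. E \<subseteq> B"
    using assms(2) by (auto simp: coarse_base_def)
  then show "E \<in> coarse_of_base X \<B>" by (simp add: coarse_of_base_def)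
next
  fix E assume "E \<in> coarse_of_base X \<B>"
  then obtain B where B: "Id_on X \<subseteq> E" "B \<in> \<B>" "E \<subseteq> B"
    by (auto simp: coarse_of_base_def)
  then have "B \<in> \<E>" using assms(2) by (auto simp: coarse_base_def)
  moreover have "\<forall>E\<in>\<E>. \<forall>E'. Id_on X \<subseteq> E' \<and> E' \<subseteq> E \<longrightarrow> E' \<in> \<E>"
    using assms(1) unfolding coarse_space_def by (elim conjE)
  ultimately show "E \<in> \<E>" using B by metis
qed

definition finitary :: "'a set \<Rightarrow> ('a \<times> 'a) set set \<Rightarrow> bool" where
  "finitary X \<E> \<longleftrightarrow>
     (\<forall>E\<in>\<E>. \<exists>n::nat. \<forall>x\<in>X. finite (E `` {x}) \<and> card (E `` {x}) < n)"

definition macro_uniform ::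
    "'a set \<Rightarrow> ('a \<times> 'a) set set \<Rightarrow> 'b set \<Rightarrow> ('b \<times> 'b) set set \<Rightarrow> ('a \<Rightarrow> 'b) \<Rightarrow> bool" where
  "macro_uniform X \<E> X' \<E>' f \<longleftrightarrow>
     f ` X \<subseteq> X' \<and> (\<forall>E\<in>\<E>. \<exists>E'\<in>\<E>'. \<forall>x\<in>X. f ` (E `` {x}) \<subseteq> E' `` {f x})"

definition induced_coarse :: "('a \<times> 'a) set set \<Rightarrow> 'a set \<Rightarrow> ('a \<times> 'a) set set" where
  "induced_coarse \<E> Y = {E \<inter> (Y \<times> Y) | E. E \<in> \<E>}"

definition asymorphic_embedding ::
    "'a set \<Rightarrow> ('a \<times> 'a) set set \<Rightarrow> 'b set \<Rightarrow> ('b \<times> 'b) set set \<Rightarrow> ('a \<Rightarrow> 'b) \<Rightarrow> bool" where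
  "asymorphic_embedding X \<E> X' \<E>' f \<longleftrightarrow>
     inj_on f X \<and> macro_uniform X \<E> X' \<E>' f \<and>
     macro_uniform (f ` X) (induced_coarse \<E>' (f ` X)) X \<E> (inv_into X f)"

definition conj_set :: "('g, 'm) monoid_scheme \<Rightarrow> 'g \<Rightarrow> 'g set \<Rightarrow> 'g set" where
  "conj_set G x F = {inv\<^bsub>G\<^esub> g \<otimes>\<^bsub>G\<^esub> x \<otimes>\<^bsub>G\<^esub> g | g. g \<in> F}"

definition conj_base :: "('g, 'm) monoid_scheme \<Rightarrow> ('g \<times> 'g) set set" where
  "conj_base G =
     {{(x, y). x \<in> carrier G \<and> y \<in> carrier G \<and> y \<in> conj_set G x F} | F.
        finite F \<and> F \<subseteq> carrier G \<and> \<one>\<^bsub>G\<^esub> \<in> F}"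

definition conj_coarse :: "('g, 'm) monoid_scheme \<Rightarrow> ('g \<times> 'g) set set" where
  "conj_coarse G = coarse_of_base (carrier G) (conj_base G)"

lemma conj_coarse_base:
  assumes "group G"
  shows "coarse_base (conj_base G) (conj_coarse G)"
proof -
  interpret group G by fact
  have "Id_on (carrier G) \<subseteq> B" if B: "B \<in> conj_base G" for B
  proof -
    obtain F where F: "\<one>\<^bsub>G\<^esub> \<in> F"
      "B = {(x, y). x \<in> carrier G \<and> y \<in> carrier G \<and> y \<in> conj_set G x F}"
      using B unfolding conj_base_def by blast
    have "x \<in> conj_set G x F" if "x \<in> carrier G" for x
      unfolding conj_set_def using F(1) that by (auto intro!: exI[of _ "\<one>\<^bsub>G\<^esub>"])
    then show ?thesis using F(2) by auto
  qed
  then have "conj_base G \<subseteq> conj_coarse G"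
    unfolding conj_coarse_def coarse_of_base_def by (intro subsetI CollectI conjI) auto
  then show ?thesis
    by (simp add: coarse_base_def conj_coarse_def coarse_of_base_def)
qed

lemma conj_coarse_space:
  assumes "group G"
  shows "coarse_space (carrier G) (conj_coarse G)"
proof -
  interpret group G by fact
  define R where
    "R F = {(x, y). x \<in> carrier G \<and> y \<in> carrier G \<and> y \<in> conj_set G x F}" for F
  define ok where "ok F \<longleftrightarrow> finite F \<and> F \<subseteq> carrier G \<and> \<one>\<^bsub>G\<^esub> \<in> F" for F
  have mem: "E \<in> conj_coarse G \<longleftrightarrow> Id_on (carrier G) \<subseteq> E \<and> (\<exists>F. ok F \<and> E \<subseteq> R F)" for E
    unfolding conj_coarse_def coarse_of_base_def conj_base_def R_def[symmetric] ok_def[symmetric]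
    by auto
  have diag: "Id_on (carrier G) \<in> conj_coarse G"
  proof -
    have "ok {\<one>\<^bsub>G\<^esub>}" by (simp add: ok_def)
    moreover have "Id_on (carrier G) \<subseteq> R {\<one>\<^bsub>G\<^esub>}" by (auto simp: R_def conj_set_def)
    ultimately show ?thesis unfolding mem by blast
  qed
  have comp: "E O E' \<in> conj_coarse G" if EE': "E \<in> conj_coarse G" "E' \<in> conj_coarse G" for E E'
  proof -
    obtain F F' where F: "ok F" "E \<subseteq> R F" "ok F'" "E' \<subseteq> R F'" using EE' unfolding mem by blast
    define H where "H = (\<lambda>(a, b). a \<otimes>\<^bsub>G\<^esub> b) ` (F \<times> F')"
    have "ok H" using F(1,3) unfolding ok_def H_def by force
    moreover have "R F O R F' \<subseteq> R H"
    proof clarify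
      fix x y z assume "(x, y) \<in> R F" "(y, z) \<in> R F'"
      then obtain a b where ab: "a \<in> F" "b \<in> F'" and x: "x \<in> carrier G" and z: "z \<in> carrier G"
        and y: "y = inv\<^bsub>G\<^esub> a \<otimes>\<^bsub>G\<^esub> x \<otimes>\<^bsub>G\<^esub> a" "z = inv\<^bsub>G\<^esub> b \<otimes>\<^bsub>G\<^esub> y \<otimes>\<^bsub>G\<^esub> b"
        by (auto simp: R_def conj_set_def)
      have "a \<in> carrier G" "b \<in> carrier G" using ab F(1,3) by (auto simp: ok_def)
      then have "z = inv\<^bsub>G\<^esub> (a \<otimes>\<^bsub>G\<^esub> b) \<otimes>\<^bsub>G\<^esub> x \<otimes>\<^bsub>G\<^esub> (a \<otimes>\<^bsub>G\<^esub> b)"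
        using x y by (simp add: inv_mult_group m_assoc)
      moreover have "a \<otimes>\<^bsub>G\<^esub> b \<in> H" using ab by (force simp: H_def)
      ultimately show "(x, z) \<in> R H" using x z by (auto simp: R_def conj_set_def)
    qed
    moreover have "Id_on (carrier G) \<subseteq> E O E'" using EE' unfolding mem by blast
    moreover have "E O E' \<subseteq> R F O R F'" using F(2,4) by (rule relcomp_mono)
    ultimately show ?thesis unfolding mem by (meson order_trans)
  qed
  have conv: "converse E \<in> conj_coarse G" if E: "E \<in> conj_coarse G" for E
  proof -
    obtain F where F: "ok F" "E \<subseteq> R F" using E unfolding mem by blast
    define H where "H = (\<lambda>a. inv\<^bsub>G\<^esub> a) ` F"
    have "ok H" using F(1) unfolding ok_def H_def by force
    moreover have "converse (R F) \<subseteq> R H"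
    proof clarify
      fix x y assume "(x, y) \<in> R F"
      then obtain a where a: "a \<in> F" and xy: "x \<in> carrier G" "y \<in> carrier G"
        and y: "y = inv\<^bsub>G\<^esub> a \<otimes>\<^bsub>G\<^esub> x \<otimes>\<^bsub>G\<^esub> a"
        by (auto simp: R_def conj_set_def)
      have ac: "a \<in> carrier G" using a F(1) by (auto simp: ok_def)
      have "a \<otimes>\<^bsub>G\<^esub> y = x \<otimes>\<^bsub>G\<^esub> a" using ac xy(1) y by (simp add: m_assoc[symmetric])
      then have "x = inv\<^bsub>G\<^esub> (inv\<^bsub>G\<^esub> a) \<otimes>\<^bsub>G\<^esub> y \<otimes>\<^bsub>G\<^esub> inv\<^bsub>G\<^esub> a"
        using ac xy by (simp add: m_assoc)
      then show "(y, x) \<in> R H" using a xy by (auto simp: R_def conj_set_def H_def)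
    qed
    moreover have "Id_on (carrier G) \<subseteq> converse E" using E unfolding mem by blast
    moreover have "converse E \<subseteq> converse (R F)" using F(2) by simp
    ultimately show ?thesis unfolding mem by (meson order_trans)
  qed
  have sub: "E \<subseteq> carrier G \<times> carrier G \<and> Id_on (carrier G) \<subseteq> E" if "E \<in> conj_coarse G" for E
  proof -
    have "R F \<subseteq> carrier G \<times> carrier G" for F by (auto simp: R_def)
    then show ?thesis using that unfolding mem by (meson order_trans)
  qed
  have down: "E' \<in> conj_coarse G"
    if "E \<in> conj_coarse G" "Id_on (carrier G) \<subseteq> E'" "E' \<subseteq> E" for E E'
    using that unfolding mem by (meson order_trans)
  show ?thesis
    unfolding coarse_space_def
  proof (intro conjI ballI allI impI)
    show "conj_coarse G \<noteq> {}" using diag by (metis empty_iff)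
    show "E \<subseteq> carrier G \<times> carrier G" "Id_on (carrier G) \<subseteq> E" "converse E \<in> conj_coarse G"
      if "E \<in> conj_coarse G" for E
      using sub[OF that] conv[OF that] by blast+
    show "E O E' \<in> conj_coarse G" if "E \<in> conj_coarse G" "E' \<in> conj_coarse G" for E E'
      using that by (rule comp)
    show "E' \<in> conj_coarse G"
      if "E \<in> conj_coarse G" "Id_on (carrier G) \<subseteq> E' \<and> E' \<subseteq> E" for E E'
      using down[OF that(1)] that(2) by blast
  qed
qed

end

theory Submission imports Defs begin

text \<open>
  Let \<open>S\<close> be the group of permutations of \<open>X\<close> whose graph lies in an entourage, and let \<open>G\<close> be the
  semidirect product of the power set of \<open>X\<close> (under symmetric difference) with \<open>S\<close>. The normal
  factor is abelian, so conjugating \<open>({x}, id)\<close> by \<open>(A, s)\<close> gives \<open>({s\<^sup>-\<^sup>1 x}, id)\<close>; hence on the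
  singletons the conjugation structure is generated by the graphs of finitely many elements of \<open>S\<close>.
  It remains to cover a symmetric entourage \<open>E\<close> by finitely many such graphs. Colour \<open>X\<close> with
  finitely many colours so that distinct \<open>E O E\<close>-related points get distinct colours. Then each
  \<open>E[x]\<close> contains at most one point of each colour, and for any two colours \<open>i\<close>, \<open>j\<close> exchanging the
  \<open>E\<close>-related points coloured \<open>i\<close> and \<open>j\<close> is an involution.
\<close>

section \<open>Colouring and covering by involutions\<close>

text \<open>Greedy choice along a well-order: the neighbours of a point occupy fewer than
  \<open>n\<close> colours, so one of the \<open>n\<close> colours is always free.\<close>

lemma greedy_coloring:
  fixes D :: "('a \<times> 'a) set"
  assumes "\<And>x. finite (D `` {x})" and "\<And>x. card (D `` {x}) < n" and "sym D"
  obtains c :: "'a \<Rightarrow> nat"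
    where "\<And>x. c x < n" and "\<And>x y. (x, y) \<in> D \<Longrightarrow> x \<noteq> y \<Longrightarrow> c x \<noteq> c y"
proof -
  obtain r :: "'a rel" where r: "well_order_on UNIV r"
    using well_order_on by blast
  define R where "R = r - Id"
  have "wf R" using r by (simp add: well_order_on_def R_def)
  have R_total: "(x, y) \<in> R \<or> (y, x) \<in> R" if "x \<noteq> y" for x y
    using r that
    by (auto simp: R_def well_order_on_def linear_order_on_def total_on_def)
  have "\<exists>c. \<forall>x. c x < n \<and> (\<forall>z. (z, x) \<in> R \<and> (x, z) \<in> D \<longrightarrow> c z \<noteq> c x)"
  proof (rule dependent_wf_choice[OF \<open>wf R\<close>,
        \<comment> \<open>Only neighbours preceding \<open>x\<close> constrain its colour, so
          \<open>P\<close> depends on \<open>c\<close> only below \<open>x\<close>, as well-founded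
          choice demands. Totality of the order later recovers all neighbours.\<close>
        where P = "\<lambda>c x k. k < n \<and> (\<forall>z. (z, x) \<in> R \<and> (x, z) \<in> D \<longrightarrow> c z \<noteq> k)"])
    fix x and c :: "'a \<Rightarrow> nat"
    have "card (c ` (D `` {x})) < card {..<n}"
      using card_image_le[OF assms(1), of c x] assms(2)[of x] by simp
    then have "\<not> {..<n} \<subseteq> c ` (D `` {x})"
      using card_mono[of "c ` (D `` {x})" "{..<n}"] assms(1)[of x] by auto
    then show "\<exists>k. k < n \<and> (\<forall>z. (z, x) \<in> R \<and> (x, z) \<in> D \<longrightarrow> c z \<noteq> k)"
      by blast
  qed auto
  then obtain c where c: "\<And>x. c x < n" "\<And>x z. (z, x) \<in> R \<Longrightarrow> (x, z) \<in> D \<Longrightarrow> c z \<noteq> c x"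
    by metis
  show thesis
  proof (rule that)
    show "c x < n" for x by (rule c)
    show "c x \<noteq> c y" if "(x, y) \<in> D" "x \<noteq> y" for x y
      using R_total[OF that(2)] c(2)[of x y] c(2)[of y x] that(1) symD[OF \<open>sym D\<close> that(1)]
      by metis
  qed
qed

text \<open>For fixed colours \<open>i\<close> and \<open>j\<close>, the pairs in \<open>E\<close>
  with these endpoint colours form a partial matching (loops if \<open>i = j\<close>). Fixed points
  complete it to an involution, and there are finitely many choices of \<open>i\<close> and
  \<open>j\<close>.\<close>

lemma symmetric_relation_covered_by_involutions:
  assumes "sym E" and "refl_on X E" and "E \<subseteq> X \<times> X"
    and fin: "\<And>x. x \<in> X \<Longrightarrow> finite ((E O E) `` {x}) \<and> card ((E O E) `` {x}) < n"
  obtains T :: "('a \<Rightarrow> 'a) set"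
    where "finite T"
      and "\<And>s x. s \<in> T \<Longrightarrow> s (s x) = x"
      and "\<And>s x. s \<in> T \<Longrightarrow> x \<in> X \<Longrightarrow> (x, s x) \<in> E"
      and "\<And>s x. s \<in> T \<Longrightarrow> x \<notin> X \<Longrightarrow> s x = x"
      and "\<And>x y. (x, y) \<in> E \<Longrightarrow> \<exists>s\<in>T. s x = y"
proof -
  \<comment> \<open>The colouring needs a bound on the whole type. Outside \<open>X\<close> the ball
    is empty, and \<open>Suc n\<close> keeps the strict inequality even when \<open>n = 0\<close>,
    which is possible for empty \<open>X\<close>.\<close>
  have D: "finite ((E O E) `` {x}) \<and> card ((E O E) `` {x}) < Suc n" for x
  proof (cases "x \<in> X")
    case True
    then show ?thesis using fin[of x] by auto
  next
    case False
    then have "(E O E) `` {x} = {}" using assms(3) by auto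
    then show ?thesis by simp
  qed
  have "sym (E O E)"
    using \<open>sym E\<close> by (metis converse_relcomp sym_conv_converse_eq)
  obtain c :: "'a \<Rightarrow> nat" where c: "\<And>x. c x < Suc n"
    and c_inj: "\<And>x y. (x, y) \<in> E O E \<Longrightarrow> x \<noteq> y \<Longrightarrow> c x \<noteq> c y"
    using greedy_coloring[of "E O E" "Suc n"] D \<open>sym (E O E)\<close> by blast
  \<comment> \<open>By symmetry \<open>y\<close> and \<open>z\<close> are related by
    \<open>E O E\<close> through \<open>x\<close>, so equal colours force equality.\<close>
  have E_inj: "y = z" if "(x, y) \<in> E" "(x, z) \<in> E" "c y = c z" for x y z
    using c_inj[of y z] that symD[OF \<open>sym E\<close> that(1)] by blast
  define P where "P i j x y \<longleftrightarrow> (x, y) \<in> E \<and> (c x = i \<and> c y = j \<or> c x = j \<and> c y = i)" for i j x y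
  define s where "s i j x = (if \<exists>y. P i j x y then THE y. P i j x y else x)" for i j x
  \<comment> \<open>The colour of \<open>x\<close> determines the colour of its partner, also when
    \<open>i = j\<close>.\<close>
  have P_unique: "y = z" if "P i j x y" "P i j x z" for i j x y z
    using that E_inj[of x y z] unfolding P_def by metis
  have s_eq: "s i j x = y" if "P i j x y" for i j x y
    using the_equality[of "P i j x", OF that P_unique[OF _ that]] that unfolding s_def by metis
  have s_none: "s i j x = x" if "\<And>y. \<not> P i j x y" for i j x
    using that by (simp add: s_def)
  have P_sym: "P i j y x" if "P i j x y" for i j x y
    using that symD[OF \<open>sym E\<close>] unfolding P_def by blast
  define T where "T = (\<lambda>(i, j). s i j) ` ({..<Suc n} \<times> {..<Suc n})"
  show thesis
  proof (rule that)
    show "finite T" by (simp add: T_def)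
    show "t (t x) = x" if "t \<in> T" for t x
    proof -
      obtain i j where t: "t = s i j" using \<open>t \<in> T\<close> by (auto simp: T_def)
      show ?thesis
      proof (cases "\<exists>y. P i j x y")
        case True
        then show ?thesis using s_eq P_sym t by metis
      next
        case False
        then show ?thesis using s_none t by metis
      qed
    qed
    show "(x, t x) \<in> E" if "t \<in> T" "x \<in> X" for t x
    proof -
      obtain i j where t: "t = s i j" using \<open>t \<in> T\<close> by (auto simp: T_def)
      show ?thesis
      proof (cases "\<exists>y. P i j x y")
        case True
        then obtain y where "P i j x y" by blast
        then show ?thesis using s_eq t by (auto simp: P_def)
      next
        case False
        then show ?thesis using s_none[of i j x] t refl_onD[OF assms(2) \<open>x \<in> X\<close>] by simp
      qed
    qed
    show "t x = x" if "t \<in> T" "x \<notin> X" for t x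
    proof -
      obtain i j where t: "t = s i j" using \<open>t \<in> T\<close> by (auto simp: T_def)
      have "\<not> P i j x y" for y using assms(3) \<open>x \<notin> X\<close> by (auto simp: P_def)
      then show ?thesis using s_none t by metis
    qed
    show "\<exists>t\<in>T. t x = y" if "(x, y) \<in> E" for x y
    proof (rule bexI[of _ "s (c x) (c y)"])
      show "s (c x) (c y) x = y" by (rule s_eq) (simp add: P_def that)
      show "s (c x) (c y) \<in> T" using c unfolding T_def by force
    qed
  qed
qed

section \<open>Closure properties of coarse structures\<close>

lemma coarse_spaceD:
  assumes "coarse_space X \<E>"
  shows "E \<in> \<E> \<Longrightarrow> E \<subseteq> X \<times> X"
    and "E \<in> \<E> \<Longrightarrow> Id_on X \<subseteq> E"
    and "E \<in> \<E> \<Longrightarrow> E' \<in> \<E> \<Longrightarrow> E O E' \<in> \<E>"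
    and "E \<in> \<E> \<Longrightarrow> converse E \<in> \<E>"
    and "E \<in> \<E> \<Longrightarrow> Id_on X \<subseteq> E' \<Longrightarrow> E' \<subseteq> E \<Longrightarrow> E' \<in> \<E>"
    and "Id_on X \<in> \<E>"
proof -
  have ne: "\<E> \<noteq> {}" and sub: "\<forall>E\<in>\<E>. E \<subseteq> X \<times> X \<and> Id_on X \<subseteq> E"
    and comp: "\<forall>E\<in>\<E>. \<forall>E'\<in>\<E>. E O E' \<in> \<E>" and conv: "\<forall>E\<in>\<E>. converse E \<in> \<E>"
    and down: "\<forall>E\<in>\<E>. \<forall>E'. Id_on X \<subseteq> E' \<and> E' \<subseteq> E \<longrightarrow> E' \<in> \<E>"
    using assms unfolding coarse_space_def by - (elim conjE, assumption)+
  show "E \<in> \<E> \<Longrightarrow> E \<subseteq> X \<times> X" "E \<in> \<E> \<Longrightarrow> Id_on X \<subseteq> E"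
    using sub by blast+
  show "E \<in> \<E> \<Longrightarrow> E' \<in> \<E> \<Longrightarrow> E O E' \<in> \<E>" "E \<in> \<E> \<Longrightarrow> converse E \<in> \<E>"
    using comp conv by (metis, metis)
  show "E \<in> \<E> \<Longrightarrow> Id_on X \<subseteq> E' \<Longrightarrow> E' \<subseteq> E \<Longrightarrow> E' \<in> \<E>"
    using down by metis
  show "Id_on X \<in> \<E>"
    using ne sub down by (metis ex_in_conv order_refl)
qed

text \<open>Both entourages contain the diagonal, so each lies in the composition
  \<open>E O E'\<close>.\<close>

lemma coarse_space_Un:
  assumes "coarse_space X \<E>" and "E \<in> \<E>" and "E' \<in> \<E>"
  shows "E \<union> E' \<in> \<E>"
proof (rule coarse_spaceD(5)[OF assms(1)])
  note D = coarse_spaceD(1,2)[OF assms(1)]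
  show "E O E' \<in> \<E>" by (rule coarse_spaceD(3)[OF assms])
  show "Id_on X \<subseteq> E \<union> E'" using D(2)[OF assms(2)] by blast
  show "E \<union> E' \<subseteq> E O E'"
    using D[OF assms(2)] D[OF assms(3)] by fast
qed

section \<open>The group of subsets and bounded permutations\<close>

text \<open>Permutations of \<open>X\<close> are extended by the identity to the whole type, so that
  \<open>id\<close>, composition and \<open>inv_into UNIV\<close> serve as the group
  operations.\<close>

definition bounded_perms :: "'a set \<Rightarrow> ('a \<times> 'a) set set \<Rightarrow> ('a \<Rightarrow> 'a) set" where
  "bounded_perms X \<E> =
     {s. bij s \<and> (\<forall>x. x \<notin> X \<longrightarrow> s x = x) \<and> (\<exists>E\<in>\<E>. \<forall>x\<in>X. (x, s x) \<in> E)}"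

text \<open>This is the unrestricted permutational wreath product of the group of order two with
  \<open>bounded_perms X \<E>\<close>; a subset stands for its indicator function.\<close>

definition perm_semidirect :: "'a set \<Rightarrow> ('a \<times> 'a) set set \<Rightarrow> ('a set \<times> ('a \<Rightarrow> 'a)) monoid" where
  "perm_semidirect X \<E> =
     \<lparr>carrier = Pow X \<times> bounded_perms X \<E>,
      mult = (\<lambda>(A, s) (B, t). (sym_diff A (s ` B), s \<circ> t)),
      one = ({}, id)\<rparr>"

lemma perm_semidirect_simps:
  "carrier (perm_semidirect X \<E>) = Pow X \<times> bounded_perms X \<E>"
  "(A, s) \<otimes>\<^bsub>perm_semidirect X \<E>\<^esub> (B, t) = (sym_diff A (s ` B), s \<circ> t)"
  "\<one>\<^bsub>perm_semidirect X \<E>\<^esub> = ({}, id)"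
  by (simp_all add: perm_semidirect_def)

lemma bounded_permsD:
  assumes "coarse_space X \<E>" and "s \<in> bounded_perms X \<E>"
  shows "bij s" and "x \<notin> X \<Longrightarrow> s x = x" and "\<exists>E\<in>\<E>. \<forall>x\<in>X. (x, s x) \<in> E"
    and "x \<in> X \<Longrightarrow> s x \<in> X"
proof -
  show "bij s" "x \<notin> X \<Longrightarrow> s x = x" "\<exists>E\<in>\<E>. \<forall>x\<in>X. (x, s x) \<in> E"
    using assms(2) by (auto simp: bounded_perms_def)
  show "s x \<in> X" if "x \<in> X"
    using \<open>\<exists>E\<in>\<E>. \<forall>x\<in>X. (x, s x) \<in> E\<close> that coarse_spaceD(1)[OF assms(1)] by blast
qed

lemma bounded_perms_id:
  assumes "coarse_space X \<E>"
  shows "id \<in> bounded_perms X \<E>"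
  using coarse_spaceD(6)[OF assms] by (auto simp: bounded_perms_def intro!: bexI[of _ "Id_on X"])

lemma bounded_perms_comp:
  assumes "coarse_space X \<E>" and s: "s \<in> bounded_perms X \<E>" and t: "t \<in> bounded_perms X \<E>"
  shows "s \<circ> t \<in> bounded_perms X \<E>"
proof -
  obtain E E' where E: "E \<in> \<E>" "\<And>x. x \<in> X \<Longrightarrow> (x, s x) \<in> E"
    and E': "E' \<in> \<E>" "\<And>x. x \<in> X \<Longrightarrow> (x, t x) \<in> E'"
    using bounded_permsD(3)[OF assms(1)] s t by meson
  \<comment> \<open>The permutation \<open>t\<close> acts first, and relational composition reads
    from left to right.\<close>
  have "E' O E \<in> \<E>" by (rule coarse_spaceD(3)[OF assms(1) E'(1) E(1)])
  moreover have "(x, (s \<circ> t) x) \<in> E' O E" if "x \<in> X" for x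
    using E(2) E'(2) that bounded_permsD(4)[OF assms(1) t that] by auto
  ultimately have "\<exists>E\<in>\<E>. \<forall>x\<in>X. (x, (s \<circ> t) x) \<in> E" by blast
  then show ?thesis
    using bounded_permsD(1,2)[OF assms(1) s] bounded_permsD(1,2)[OF assms(1) t]
    by (auto simp: bounded_perms_def intro: bij_comp)
qed

lemma bounded_perms_inv:
  assumes "coarse_space X \<E>" and s: "s \<in> bounded_perms X \<E>"
  shows "inv_into UNIV s \<in> bounded_perms X \<E>"
proof -
  have "bij s" by (rule bounded_permsD(1)[OF assms])
  have off_X: "inv_into UNIV s x = x" if "x \<notin> X" for x
    using bounded_permsD(2)[OF assms that] \<open>bij s\<close> by (metis bij_inv_eq_iff)
  \<comment> \<open>A preimage outside \<open>X\<close> would be fixed by \<open>s\<close> and hence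
    equal to \<open>x\<close>, which lies in \<open>X\<close>.\<close>
  have inX: "inv_into UNIV s x \<in> X" if "x \<in> X" for x
    using bounded_permsD(2)[OF assms, of "inv_into UNIV s x"] that \<open>bij s\<close> by (metis bij_inv_eq_iff)
  obtain E where E: "E \<in> \<E>" "\<And>x. x \<in> X \<Longrightarrow> (x, s x) \<in> E"
    using bounded_permsD(3)[OF assms] by blast
  have "converse E \<in> \<E>" by (rule coarse_spaceD(4)[OF assms(1) E(1)])
  moreover have "(x, inv_into UNIV s x) \<in> converse E" if "x \<in> X" for x
    using E(2)[OF inX[OF that]] \<open>bij s\<close> by (simp add: bij_is_surj surj_f_inv_f)
  ultimately have "\<exists>E\<in>\<E>. \<forall>x\<in>X. (x, inv_into UNIV s x) \<in> E" by blast
  then show ?thesis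
    using off_X \<open>bij s\<close> by (auto simp: bounded_perms_def intro: bij_imp_bij_inv)
qed

text \<open>Permutations thus act on subsets by automorphisms, which gives associativity of the
  semidirect product.\<close>

lemma image_sym_diff:
  assumes "inj s"
  shows "s ` sym_diff A B = sym_diff (s ` A) (s ` B)"
  using assms by (simp add: image_Un image_set_diff)

lemma group_perm_semidirect:
  assumes "coarse_space X \<E>"
  shows "group (perm_semidirect X \<E>)"
proof (rule groupI, goal_cases)
  case (1 x y)
  then obtain A s B t where xy: "x = (A, s)" "y = (B, t)" "A \<subseteq> X" "B \<subseteq> X"
    and st: "s \<in> bounded_perms X \<E>" "t \<in> bounded_perms X \<E>"
    by (auto simp: perm_semidirect_simps)
  then show ?case
    using bounded_perms_comp[OF assms st] bounded_permsD(4)[OF assms st(1)]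
    by (auto simp: perm_semidirect_simps)
next
  case 2
  then show ?case by (simp add: perm_semidirect_simps bounded_perms_id[OF assms])
next
  case (3 x y z)
  then obtain A s B t C u where xyz: "x = (A, s)" "y = (B, t)" "z = (C, u)"
    and "s \<in> bounded_perms X \<E>"
    by (auto simp: perm_semidirect_simps)
  then have "inj s" using bounded_permsD(1)[OF assms] bij_is_inj by blast
  then show ?case
    unfolding xyz perm_semidirect_simps image_sym_diff[OF \<open>inj s\<close>] image_comp comp_assoc by blast
next
  case (4 x)
  then show ?case by (auto simp: perm_semidirect_simps)
next
  case (5 x)
  then obtain A s where x: "x = (A, s)" "A \<subseteq> X" and s: "s \<in> bounded_perms X \<E>"
    by (auto simp: perm_semidirect_simps)
  have "inj s" using bounded_permsD(1)[OF assms s] bij_is_inj by blast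
  have "(inv_into UNIV s ` A, inv_into UNIV s) \<in> carrier (perm_semidirect X \<E>)"
    using bounded_perms_inv[OF assms s] bounded_permsD(4)[OF assms bounded_perms_inv[OF assms s]] x
    by (auto simp: perm_semidirect_simps)
  moreover have "(inv_into UNIV s ` A, inv_into UNIV s) \<otimes>\<^bsub>perm_semidirect X \<E>\<^esub> x = \<one>\<^bsub>perm_semidirect X \<E>\<^esub>"
    using \<open>inj s\<close> by (simp add: x perm_semidirect_simps)
  ultimately show ?case by blast
qed

text \<open>The component \<open>A\<close> cancels because symmetric difference is commutative, so
  conjugation moves singletons through the permutation alone.\<close>

lemma perm_semidirect_conj:
  assumes "coarse_space X \<E>" and "x \<in> X" and "(A, s) \<in> carrier (perm_semidirect X \<E>)"
  shows "inv\<^bsub>perm_semidirect X \<E>\<^esub> (A, s) \<otimes>\<^bsub>perm_semidirect X \<E>\<^esub> ({x}, id)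
           \<otimes>\<^bsub>perm_semidirect X \<E>\<^esub> (A, s) = ({inv_into UNIV s x}, id)"
proof -
  interpret group "perm_semidirect X \<E>" by (rule group_perm_semidirect[OF assms(1)])
  have s: "s \<in> bounded_perms X \<E>" using assms(3) by (simp add: perm_semidirect_simps)
  have carr: "({x}, id) \<in> carrier (perm_semidirect X \<E>)"
    "({inv_into UNIV s x}, id) \<in> carrier (perm_semidirect X \<E>)"
    using assms(2) bounded_perms_id[OF assms(1)]
      bounded_permsD(4)[OF assms(1) bounded_perms_inv[OF assms(1) s]]
    by (auto simp: perm_semidirect_simps)
  have "s (inv_into UNIV s x) = x"
    using bounded_permsD(1)[OF assms(1) s] by (simp add: bij_is_surj surj_f_inv_f)
  \<comment> \<open>Comparing the two products avoids computing the inverse of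
    \<open>(A, s)\<close>: both equal \<open>(sym_diff A {x}, s)\<close>.\<close>
  then have "({x}, id) \<otimes>\<^bsub>perm_semidirect X \<E>\<^esub> (A, s)
      = (A, s) \<otimes>\<^bsub>perm_semidirect X \<E>\<^esub> ({inv_into UNIV s x}, id)"
    by (auto simp: perm_semidirect_simps)
  then have "inv\<^bsub>perm_semidirect X \<E>\<^esub> (A, s)
      \<otimes>\<^bsub>perm_semidirect X \<E>\<^esub> (({x}, id) \<otimes>\<^bsub>perm_semidirect X \<E>\<^esub> (A, s)) = ({inv_into UNIV s x}, id)"
    using carr assms(3) by (simp add: inv_solve_left')
  then show ?thesis using carr assms(3) by (simp add: m_assoc)
qed

section \<open>Entourages and finite sets of bounded permutations\<close>

lemma finite_bounded_perms_entourage: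
  assumes "coarse_space X \<E>" and "finite T" and "T \<subseteq> bounded_perms X \<E>"
  shows "\<exists>E\<in>\<E>. \<forall>s\<in>T. \<forall>x\<in>X. (x, s x) \<in> E"
  using assms(2,3)
proof (induction T)
  case empty
  then show ?case using coarse_spaceD(6)[OF assms(1)] by blast
next
  case (insert s T)
  then obtain E E' where "E \<in> \<E>" "\<forall>s\<in>T. \<forall>x\<in>X. (x, s x) \<in> E"
    and "E' \<in> \<E>" "\<forall>x\<in>X. (x, s x) \<in> E'"
    using bounded_permsD(3)[OF assms(1)] by (metis insert_subset)
  then show ?case
    using coarse_space_Un[OF assms(1), of E E'] by (intro bexI[of _ "E \<union> E'"]) auto
qed

text \<open>The inverse appears because conjugation by \<open>(A, s)\<close> moves \<open>x\<close>
  by the inverse of \<open>s\<close>. It costs nothing here, since the covering permutations are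
  involutions.\<close>

lemma finitary_entourage_covered_by_perms:
  assumes cs: "coarse_space X \<E>" and fin: "finitary X \<E>" and E: "E \<in> \<E>"
  obtains T where "finite T" and "T \<subseteq> bounded_perms X \<E>"
    and "\<And>x y. (x, y) \<in> E \<Longrightarrow> \<exists>s\<in>T. inv_into UNIV s x = y"
proof -
  \<comment> \<open>The covering by involutions needs a symmetric relation; finitarity is then
    applied to \<open>D O D\<close>, whose balls bound the number of colours.\<close>
  define D where "D = E \<union> converse E"
  have "converse E \<in> \<E>" by (rule coarse_spaceD(4)[OF cs E])
  then have D: "D \<in> \<E>" unfolding D_def using coarse_space_Un cs E by blast
  then have DX: "D \<subseteq> X \<times> X" "Id_on X \<subseteq> D" and "D O D \<in> \<E>"
    using coarse_spaceD(1-3)[OF cs] by simp_all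
  obtain n where n: "\<And>x. x \<in> X \<Longrightarrow> finite ((D O D) `` {x}) \<and> card ((D O D) `` {x}) < n"
    using fin \<open>D O D \<in> \<E>\<close> unfolding finitary_def by meson
  have "sym D" "refl_on X D"
    using DX by (auto simp: D_def sym_def refl_on_def)
  show thesis
  proof (rule symmetric_relation_covered_by_involutions[OF \<open>sym D\<close> \<open>refl_on X D\<close> DX(1) n])
    fix T
    assume T: "finite T" "\<And>s x. s \<in> T \<Longrightarrow> s (s x) = x"
      "\<And>s x. s \<in> T \<Longrightarrow> x \<in> X \<Longrightarrow> (x, s x) \<in> D" "\<And>s x. s \<in> T \<Longrightarrow> x \<notin> X \<Longrightarrow> s x = x"
      "\<And>x y. (x, y) \<in> D \<Longrightarrow> \<exists>s\<in>T. s x = y"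
    have invol: "bij s \<and> inv_into UNIV s = s" if "s \<in> T" for s
      using T(2)[OF that] by (metis involuntory_imp_bij inv_equality)
    show thesis
    proof (rule that)
      show "finite T" by (rule T(1))
      show "T \<subseteq> bounded_perms X \<E>"
        using invol T(3,4) D unfolding bounded_perms_def by blast
      show "\<exists>s\<in>T. inv_into UNIV s x = y" if "(x, y) \<in> E" for x y
        using T(5)[of x y] that invol unfolding D_def by force
    qed
  qed
qed

section \<open>The embedding by singletons\<close>

theorem theorem7:
  fixes X :: "'a set" and \<E> :: "('a \<times> 'a) set set"
  assumes "coarse_space X \<E>" and "finitary X \<E>"
  shows "\<exists>(G :: ('a set \<times> ('a \<Rightarrow> 'a)) monoid) f.
           group G \<and> asymorphic_embedding X \<E> (carrier G) (conj_coarse G) f"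
proof -
  note cs = assms(1)
  define G where "G = perm_semidirect X \<E>"
  define f :: "'a \<Rightarrow> 'a set \<times> ('a \<Rightarrow> 'a)" where "f x = ({x}, id)" for x
  have "group G" unfolding G_def by (rule group_perm_semidirect[OF cs])
  have inj: "inj_on f X" by (auto simp: inj_on_def f_def)
  have f_carr: "f x \<in> carrier G" if "x \<in> X" for x
    using that bounded_perms_id[OF cs] by (simp add: f_def G_def perm_semidirect_simps)
  have conj: "inv\<^bsub>G\<^esub> g \<otimes>\<^bsub>G\<^esub> f x \<otimes>\<^bsub>G\<^esub> g = f (inv_into UNIV (snd g) x)" if "x \<in> X" "g \<in> carrier G" for x g
    using perm_semidirect_conj[OF cs that(1), of "fst g" "snd g"] that(2)
    by (simp add: f_def G_def)
  have "macro_uniform X \<E> (carrier G) (conj_coarse G) f"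
    unfolding macro_uniform_def
  proof (intro conjI ballI)
    show "f ` X \<subseteq> carrier G" using f_carr by blast
    fix E assume E: "E \<in> \<E>"
    then have EX: "E \<subseteq> X \<times> X" by (rule coarse_spaceD(1)[OF cs])
    obtain T where T: "finite T" "T \<subseteq> bounded_perms X \<E>"
      "\<And>x y. (x, y) \<in> E \<Longrightarrow> \<exists>s\<in>T. inv_into UNIV s x = y"
      using finitary_entourage_covered_by_perms[OF cs assms(2) E] by metis
    \<comment> \<open>Any first component would conjugate singletons in the same way, so the empty
      set is taken; the unit is added because base sets must contain it.\<close>
    define F where "F = insert \<one>\<^bsub>G\<^esub> (Pair {} ` T)"
    define B where "B = {(x, y). x \<in> carrier G \<and> y \<in> carrier G \<and> y \<in> conj_set G x F}"
    have F: "finite F" "F \<subseteq> carrier G" "\<one>\<^bsub>G\<^esub> \<in> F"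
      using T(1,2) bounded_perms_id[OF cs]
      by (auto simp: F_def G_def perm_semidirect_simps)
    have "B \<in> conj_base G" using F unfolding conj_base_def B_def by blast
    then have "B \<in> conj_coarse G"
      using conj_coarse_base[OF \<open>group G\<close>] by (auto simp: coarse_base_def)
    moreover have "f ` (E `` {x}) \<subseteq> B `` {f x}" if "x \<in> X" for x
    proof
      fix z assume "z \<in> f ` (E `` {x})"
      then obtain y where xy: "(x, y) \<in> E" and z: "z = f y" by blast
      obtain s where s: "s \<in> T" "inv_into UNIV s x = y" using T(3)[OF xy] by blast
      then have g: "({}, s) \<in> F" by (simp add: F_def)
      then have "f y = inv\<^bsub>G\<^esub> ({}, s) \<otimes>\<^bsub>G\<^esub> f x \<otimes>\<^bsub>G\<^esub> ({}, s)"
        using conj[OF \<open>x \<in> X\<close>, of "({}, s)"] F(2) s(2) by auto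
      then have "f y \<in> conj_set G (f x) F" using g unfolding conj_set_def by blast
      then show "z \<in> B `` {f x}" using f_carr xy EX z by (auto simp: B_def)
    qed
    ultimately show "\<exists>E'\<in>conj_coarse G. \<forall>x\<in>X. f ` (E `` {x}) \<subseteq> E' `` {f x}" by blast
  qed
  moreover have "macro_uniform (f ` X) (induced_coarse (conj_coarse G) (f ` X)) X \<E> (inv_into X f)"
    unfolding macro_uniform_def
  proof (intro conjI ballI)
    show "inv_into X f ` f ` X \<subseteq> X" using inj by auto
    fix E assume "E \<in> induced_coarse (conj_coarse G) (f ` X)"
    then obtain F where F: "finite F" "F \<subseteq> carrier G"
      and EF: "\<And>u v. (u, v) \<in> E \<Longrightarrow> u \<in> f ` X \<and> v \<in> f ` X \<and> v \<in> conj_set G u F"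
      unfolding induced_coarse_def conj_coarse_def coarse_of_base_def conj_base_def by blast
    \<comment> \<open>Conjugation by \<open>F\<close> moves singletons only by these finitely many
      bounded permutations, so a single entourage \<open>D\<close> contains all their graphs over
      \<open>X\<close>.\<close>
    define T where "T = (\<lambda>g. inv_into UNIV (snd g)) ` F"
    have "T \<subseteq> bounded_perms X \<E>"
      using F(2) bounded_perms_inv[OF cs] by (auto simp: T_def G_def perm_semidirect_simps)
    then obtain D where D: "D \<in> \<E>" "\<And>s x. s \<in> T \<Longrightarrow> x \<in> X \<Longrightarrow> (x, s x) \<in> D"
      using finite_bounded_perms_entourage[OF cs, of T] F(1) by (auto simp: T_def)
    have "inv_into X f ` (E `` {u}) \<subseteq> D `` {inv_into X f u}" if "u \<in> f ` X" for u
    proof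
      fix w assume "w \<in> inv_into X f ` (E `` {u})"
      then obtain v where "(u, v) \<in> E" and w: "w = inv_into X f v" by blast
      with EF obtain x y where x: "x \<in> X" "u = f x" and y: "y \<in> X" "v = f y"
        and "v \<in> conj_set G u F"
        by blast
      then obtain g where g: "g \<in> F" "f y = f (inv_into UNIV (snd g) x)"
        using conj[OF x(1)] F(2) by (auto simp: conj_set_def)
      then have "y = inv_into UNIV (snd g) x" by (simp add: f_def)
      then have "(x, y) \<in> D" using D(2)[OF _ x(1)] g(1) by (auto simp: T_def)
      then show "w \<in> D `` {inv_into X f u}" using x y w inj by simp
    qed
    then show "\<exists>E'\<in>\<E>. \<forall>u\<in>f ` X. inv_into X f ` (E `` {u}) \<subseteq> E' `` {inv_into X f u}"
      using D(1) by blast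
  qed
  ultimately have "asymorphic_embedding X \<E> (carrier G) (conj_coarse G) f"
    using inj unfolding asymorphic_embedding_def by blast
  then show ?thesis using \<open>group G\<close> by blast
qed

end
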